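(* Let $\delta>0$ be a real number, let $P_\delta=[0,2\pi)\times[-\delta,\delta]$ be endowed with the Möbius strip topology (described in the context), and let $\mathbf{w}\colon P_\delta\to\mathbb{R}^3$ be given by $$\mathbf{w}(t,r)=\big(\cos t+r\cos\tfrac t2,\ \sin t+r\sin\tfrac t2,\ r\sin\tfrac t2\big).$$ Let the image $\mathbf{w}(P_\delta)$ carry the topology induced by the standard topology of $\mathbb{R}^3$. Then the map $P_\delta\ni(t,r)\mapsto\mathbf{w}(t,r)\in\mathbf{w}(P_\delta)$ is a homeomorphism if and only if $\delta\le\sqrt2$.
   Context: The Möbius strip (of width $2\delta$) is the set $P_\delta=[0,2\pi)\times[-\delta,\delta]$ with the topology generated by the base consisting of all sets $P_\delta\cap(B_{p,\varepsilon}\cup B_{\tilde p,\varepsilon})$, where $p=(t,r)\in P_\delta$, $\tilde p:=(t+2\pi,-r)$, $\varepsilon\in(0,\infty)$, and $B_{p,\varepsilon}$ is the open ball in $\mathbb{R}^2$ of radius $\varepsilon$ centered at $p$. Equivalently, it is the topology transported to $P_\delta$ from the quotient of the closed rectangle $[0,2\pi]\times[-\delta,\delta]$ (with its usual topology) by the identification of each point $(2\pi,r)$ with $(0,-r)$, each class being represented by its unique element in $P_\delta$. *)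

theory Defs
  imports "HOL-Analysis.Analysis"
begin

definition mobius_carrier :: "real \<Rightarrow> (real \<times> real) set"
  where "mobius_carrier \<delta> = {0..<2 * pi} \<times> {-\<delta>..\<delta>}"

definition mobius_shift :: "real \<times> real \<Rightarrow> real \<times> real"
  where "mobius_shift p = (fst p + 2 * pi, - snd p)"

definition mobius_nbhd :: "real \<Rightarrow> real \<times> real \<Rightarrow> real \<Rightarrow> (real \<times> real) set"
  where "mobius_nbhd \<delta> p \<epsilon> = mobius_carrier \<delta> \<inter> (ball p \<epsilon> \<union> ball (mobius_shift p) \<epsilon>)"

text \<open>The function \<open>topology_generated_by\<close> takes a subbase; the generating family below is in
  fact a base, see \<open>openin_mobius_strip_union_of\<close>.\<close>

definition mobius_strip :: "real \<Rightarrow> (real \<times> real) topology"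
  where "mobius_strip \<delta> =
    topology_generated_by {mobius_nbhd \<delta> p \<epsilon> | p \<epsilon>. p \<in> mobius_carrier \<delta> \<and> 0 < \<epsilon>}"

definition mobius_map :: "real \<times> real \<Rightarrow> real ^ 3"
  where "mobius_map = (\<lambda>(t, r). vector
    [cos t + r * cos (t / 2), sin t + r * sin (t / 2), r * sin (t / 2)])"

lemma mem_mobius_nbhd:
  "p \<in> mobius_carrier \<delta> \<Longrightarrow> 0 < \<epsilon> \<Longrightarrow> p \<in> mobius_nbhd \<delta> p \<epsilon>"
  by (simp add: mobius_nbhd_def)

lemma topspace_mobius_strip [simp]: "topspace (mobius_strip \<delta>) = mobius_carrier \<delta>"
proof
  show "topspace (mobius_strip \<delta>) \<subseteq> mobius_carrier \<delta>"
    unfolding mobius_strip_def topology_generated_by_topspace mobius_nbhd_def by blast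
  show "mobius_carrier \<delta> \<subseteq> topspace (mobius_strip \<delta>)"
    unfolding mobius_strip_def topology_generated_by_topspace
    using mem_mobius_nbhd zero_less_one by blast
qed

lemma dist_mobius_shift [simp]: "dist (mobius_shift p) (mobius_shift q) = dist p q"
  by (simp add: mobius_shift_def dist_prod_def dist_real_def power2_eq_square algebra_simps)

text \<open>For \<open>q\<close> on the seam \<open>t = 0\<close>, the shifted centre \<open>(2\<pi>, -r)\<close> of the neighbourhoods of \<open>q\<close> is
  the boundary point of the closed rectangle identified with \<open>q\<close>.\<close>

lemma mobius_nbhd_refine:
  assumes p: "p \<in> mobius_carrier \<delta>" and q: "q \<in> mobius_nbhd \<delta> p \<epsilon>"
  obtains \<eta> where "0 < \<eta>" "mobius_nbhd \<delta> q \<eta> \<subseteq> mobius_nbhd \<delta> p \<epsilon>"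
proof (cases "fst q = 0")
  case False
  have "0 < fst q"
    using q False by (auto simp: mobius_nbhd_def mobius_carrier_def)
  have "open (ball p \<epsilon> \<union> ball (mobius_shift p) \<epsilon>)" "q \<in> ball p \<epsilon> \<union> ball (mobius_shift p) \<epsilon>"
    using q by (auto simp: mobius_nbhd_def)
  then obtain e where e: "0 < e" "ball q e \<subseteq> ball p \<epsilon> \<union> ball (mobius_shift p) \<epsilon>"
    using open_contains_ball by metis
  have "x \<notin> ball (mobius_shift q) (min e (fst q))" if "x \<in> mobius_carrier \<delta>" for x
  proof -
    have "fst q \<le> dist (fst (mobius_shift q)) (fst x)"
      using that \<open>0 < fst q\<close> by (auto simp: mobius_carrier_def mobius_shift_def dist_real_def)
    also have "\<dots> \<le> dist (mobius_shift q) x"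
      by (rule dist_fst_le)
    finally show ?thesis by simp
  qed
  then have "mobius_nbhd \<delta> q (min e (fst q)) \<subseteq> mobius_nbhd \<delta> p \<epsilon>"
    using e(2) by (force simp: mobius_nbhd_def)
  then show ?thesis
    using that[of "min e (fst q)"] e(1) \<open>0 < fst q\<close> by simp
next
  case True
  let ?W = "ball p \<epsilon> \<union> ball (mobius_shift p) \<epsilon>"
  have "mobius_shift q \<in> ?W"
  proof (cases "q \<in> ball p \<epsilon>")
    case True
    then show ?thesis by simp
  next
    case False
    then have d: "dist (mobius_shift p) q < \<epsilon>"
      using q by (auto simp: mobius_nbhd_def)
    have "0 \<le> fst p" "fst p < 2 * pi"
      using p by (auto simp: mobius_carrier_def)
    then have "(fst p - 2 * pi)\<^sup>2 \<le> (fst p + 2 * pi)\<^sup>2"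
      by (simp add: power2_eq_square algebra_simps)
    then have "dist p (mobius_shift q) \<le> dist (mobius_shift p) q"
      using \<open>fst q = 0\<close>
      by (auto simp: mobius_shift_def dist_prod_def dist_real_def power2_eq_square algebra_simps)
    with d show ?thesis by simp
  qed
  moreover have "q \<in> ?W"
    using q by (simp add: mobius_nbhd_def)
  moreover have "open ?W" by blast
  ultimately obtain a b where "0 < a" "ball q a \<subseteq> ?W" "0 < b" "ball (mobius_shift q) b \<subseteq> ?W"
    using open_contains_ball by metis
  moreover have "ball q (min a b) \<subseteq> ball q a" "ball (mobius_shift q) (min a b) \<subseteq> ball (mobius_shift q) b"
    by auto
  ultimately have "mobius_nbhd \<delta> q (min a b) \<subseteq> mobius_nbhd \<delta> p \<epsilon>"
    unfolding mobius_nbhd_def by blast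
  then show ?thesis
    using that[of "min a b"] \<open>0 < a\<close> \<open>0 < b\<close> by simp
qed

lemma mobius_nbhd_mono: "\<epsilon> \<le> \<epsilon>' \<Longrightarrow> mobius_nbhd \<delta> p \<epsilon> \<subseteq> mobius_nbhd \<delta> p \<epsilon>'"
  by (auto simp: mobius_nbhd_def)

lemma openin_mobius_strip_iff:
  "openin (mobius_strip \<delta>) U \<longleftrightarrow>
     U \<subseteq> mobius_carrier \<delta> \<and> (\<forall>p\<in>U. \<exists>\<epsilon>>0. mobius_nbhd \<delta> p \<epsilon> \<subseteq> U)" (is "_ \<longleftrightarrow> ?R U")
proof
  let ?\<B> = "{mobius_nbhd \<delta> p \<epsilon> | p \<epsilon>. p \<in> mobius_carrier \<delta> \<and> 0 < \<epsilon>}"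
  assume U: "openin (mobius_strip \<delta>) U"
  then have "generate_topology_on ?\<B> U"
    by (simp add: mobius_strip_def openin_topology_generated_by)
  then have "\<forall>p\<in>U. \<exists>\<epsilon>>0. mobius_nbhd \<delta> p \<epsilon> \<subseteq> U"
  proof induction
    case Empty
    then show ?case by simp
  next
    case (Int A B)
    show ?case
    proof
      fix p assume "p \<in> A \<inter> B"
      then obtain a b where "0 < a" "mobius_nbhd \<delta> p a \<subseteq> A" "0 < b" "mobius_nbhd \<delta> p b \<subseteq> B"
        using Int.IH by blast
      then show "\<exists>\<epsilon>>0. mobius_nbhd \<delta> p \<epsilon> \<subseteq> A \<inter> B"
        using mobius_nbhd_mono[of "min a b" a \<delta> p] mobius_nbhd_mono[of "min a b" b \<delta> p]
        by (intro exI[of _ "min a b"]) auto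
    qed
  next
    case (UN K)
    show ?case
    proof
      fix p assume "p \<in> \<Union>K"
      then obtain k where "k \<in> K" "p \<in> k" by blast
      with UN.IH show "\<exists>\<epsilon>>0. mobius_nbhd \<delta> p \<epsilon> \<subseteq> \<Union>K"
        by (meson Union_upper order_trans)
    qed
  next
    case (Basis S)
    then obtain q \<epsilon> where S: "S = mobius_nbhd \<delta> q \<epsilon>" "q \<in> mobius_carrier \<delta>"
      by blast
    show ?case
    proof
      fix p assume "p \<in> S"
      then show "\<exists>\<epsilon>>0. mobius_nbhd \<delta> p \<epsilon> \<subseteq> S"
        using mobius_nbhd_refine[of q \<delta> p \<epsilon>] S by metis
    qed
  qed
  with openin_subset[OF U] show "?R U" by simp
next
  assume U: "?R U"
  have "\<exists>T. openin (mobius_strip \<delta>) T \<and> p \<in> T \<and> T \<subseteq> U" if "p \<in> U" for p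
  proof -
    from that U obtain \<epsilon> where "0 < \<epsilon>" "mobius_nbhd \<delta> p \<epsilon> \<subseteq> U" by blast
    moreover have "p \<in> mobius_carrier \<delta>" using that U by blast
    moreover have "openin (mobius_strip \<delta>) (mobius_nbhd \<delta> p \<epsilon>)"
      unfolding mobius_strip_def using calculation
      by (intro topology_generated_by_Basis) blast
    ultimately show ?thesis using mem_mobius_nbhd by blast
  qed
  then show "openin (mobius_strip \<delta>) U"
    by (subst openin_subopen) blast
qed

lemma openin_mobius_strip_union_of:
  "openin (mobius_strip \<delta>) = arbitrary union_of
     (\<lambda>V. V \<in> {mobius_nbhd \<delta> p \<epsilon> | p \<epsilon>. p \<in> mobius_carrier \<delta> \<and> 0 < \<epsilon>})"
  unfolding openin_topology_base_unique
proof (intro conjI allI impI)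
  fix V assume "V \<in> {mobius_nbhd \<delta> p \<epsilon> | p \<epsilon>. p \<in> mobius_carrier \<delta> \<and> 0 < \<epsilon>}"
  then show "openin (mobius_strip \<delta>) V"
    unfolding mobius_strip_def by (rule topology_generated_by_Basis)
next
  fix U p assume "openin (mobius_strip \<delta>) U \<and> p \<in> U"
  then obtain \<epsilon> where "p \<in> mobius_carrier \<delta>" "0 < \<epsilon>" "mobius_nbhd \<delta> p \<epsilon> \<subseteq> U"
    unfolding openin_mobius_strip_iff by blast
  then show "\<exists>V. V \<in> {mobius_nbhd \<delta> p \<epsilon> | p \<epsilon>. p \<in> mobius_carrier \<delta> \<and> 0 < \<epsilon>} \<and> p \<in> V \<and> V \<subseteq> U"
    using mem_mobius_nbhd by blast
qed

end

theory Submission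
  imports Defs
begin

text \<open>A pair of distinct parameters with the same image must satisfy \<open>sin t = sin s\<close>, since
  \<open>y - z = sin t\<close>; solving the other two equations gives \<open>r = -2 cos (t/2)\<close>, \<open>\<bar>q\<bar> = 2 \<bar>sin (t/2)\<bar>\<close>,
  whence \<open>r\<^sup>2 + q\<^sup>2 = 4\<close>. So one of \<open>\<bar>r\<bar>\<close>, \<open>\<bar>q\<bar>\<close> exceeds \<open>\<surd>2\<close>, unless both equal \<open>\<surd>2\<close>, which forces
  the parameters to coincide. Conversely, the curve \<open>r = -2 cos (t/2)\<close> is folded onto a
  segment, and suitable parameters \<open>t\<close>, \<open>\<pi> - t\<close> on it violate injectivity as soon as \<open>\<delta> > \<surd>2\<close>.
  An injective continuous map from the compact strip into a Hausdorff space is a homeomorphism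
  onto its image.\<close>

lemma mobius_map_eq_iff:
  "mobius_map (t, r) = mobius_map (s, q) \<longleftrightarrow>
     cos t + r * cos (t / 2) = cos s + q * cos (s / 2) \<and>
     sin t = sin s \<and> r * sin (t / 2) = q * sin (s / 2)"
  by (auto simp: mobius_map_def vec_eq_iff forall_3)

text \<open>Shifting by \<open>2 * pi\<close> adds \<open>pi\<close> to the half-angle and so
  negates its sine and cosine; negating the width coordinate undoes this. Hence the map is
  continuous across the seam.\<close>

lemma mobius_map_shift: "mobius_map (mobius_shift p) = mobius_map p"
proof -
  have h: "(t + 2 * pi) / 2 = t / 2 + pi" for t :: real by (simp add: field_simps)
  show ?thesis
    by (cases p) (simp add: mobius_shift_def mobius_map_eq_iff h)
qed

lemma isCont_mobius_map: "isCont mobius_map p"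
proof -
  have "\<forall>i. ((\<lambda>x. mobius_map x $ i) \<longlongrightarrow> mobius_map p $ i) (at p)"
    unfolding forall_3 mobius_map_def case_prod_beta vector_3
    by (intro conjI tendsto_intros) auto
  then show ?thesis
    unfolding isCont_def by (blast intro: vec_tendstoI)
qed

lemma continuous_map_mobius_map:
  "continuous_map (mobius_strip \<delta>) (top_of_set (mobius_map ` mobius_carrier \<delta>)) mobius_map"
proof -
  have "openin (mobius_strip \<delta>) {x \<in> mobius_carrier \<delta>. mobius_map x \<in> V}" if "open V" for V
    unfolding openin_mobius_strip_iff
  proof (intro conjI ballI)
    fix p assume p: "p \<in> {x \<in> mobius_carrier \<delta>. mobius_map x \<in> V}"
    have op: "open (mobius_map -` V)"
      using isCont_mobius_map \<open>open V\<close> by (simp add: continuous_on_eq_continuous_at open_vimage)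
    moreover have "p \<in> mobius_map -` V" "mobius_shift p \<in> mobius_map -` V"
      using p by (auto simp: mobius_map_shift)
    ultimately obtain a b where ab: "0 < a" "ball p a \<subseteq> mobius_map -` V"
        "0 < b" "ball (mobius_shift p) b \<subseteq> mobius_map -` V"
      using open_contains_ball by metis
    have "ball p (min a b) \<subseteq> ball p a" "ball (mobius_shift p) (min a b) \<subseteq> ball (mobius_shift p) b"
      by auto
    with ab have "mobius_nbhd \<delta> p (min a b) \<subseteq> {x \<in> mobius_carrier \<delta>. mobius_map x \<in> V}"
      unfolding mobius_nbhd_def by blast
    with ab show "\<exists>\<epsilon>>0. mobius_nbhd \<delta> p \<epsilon> \<subseteq> {x \<in> mobius_carrier \<delta>. mobius_map x \<in> V}"
      by (intro exI[of _ "min a b"]) simp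
  qed auto
  then have "continuous_map (mobius_strip \<delta>) euclidean mobius_map"
    by (simp add: continuous_map_def)
  then show ?thesis
    by (auto simp: continuous_map_in_subtopology)
qed

text \<open>The gluing of the closed rectangle, with values in the chosen representatives; it
  carries compactness over to the strip.\<close>

definition mobius_quotient :: "real \<times> real \<Rightarrow> real \<times> real"
  where "mobius_quotient x = (if fst x = 2 * pi then (0, - snd x) else x)"

lemma mobius_quotient_image:
  "mobius_quotient ` ({0..2 * pi} \<times> {-\<delta>..\<delta>}) = mobius_carrier \<delta>"
proof
  show "mobius_quotient ` ({0..2 * pi} \<times> {-\<delta>..\<delta>}) \<subseteq> mobius_carrier \<delta>"
    by (auto simp: mobius_quotient_def mobius_carrier_def)
  show "mobius_carrier \<delta> \<subseteq> mobius_quotient ` ({0..2 * pi} \<times> {-\<delta>..\<delta>})"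
  proof
    fix x assume "x \<in> mobius_carrier \<delta>"
    then show "x \<in> mobius_quotient ` ({0..2 * pi} \<times> {-\<delta>..\<delta>})"
      by (intro image_eqI[of _ _ x]) (auto simp: mobius_quotient_def mobius_carrier_def)
  qed
qed

text \<open>At a point on the right edge, the second ball of a neighbourhood of its image is centred
  at the point itself; elsewhere the quotient map is locally the identity.\<close>

lemma continuous_map_mobius_quotient:
  "continuous_map (top_of_set ({0..2 * pi} \<times> {-\<delta>..\<delta>})) (mobius_strip \<delta>) mobius_quotient"
  unfolding continuous_map_def
proof (intro conjI allI impI)
  let ?R = "{0..2 * pi} \<times> {-\<delta>..\<delta>}"
  show "mobius_quotient \<in> topspace (top_of_set ?R) \<rightarrow> topspace (mobius_strip \<delta>)"
    using mobius_quotient_image[of \<delta>] by auto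
  fix U assume U: "openin (mobius_strip \<delta>) U"
  have "\<exists>e>0. \<forall>y\<in>?R. dist y x < e \<longrightarrow> mobius_quotient y \<in> U"
    if x: "x \<in> ?R" "mobius_quotient x \<in> U" for x
  proof -
    obtain e where e: "0 < e" "mobius_nbhd \<delta> (mobius_quotient x) e \<subseteq> U"
      using U x unfolding openin_mobius_strip_iff by blast
    have carrier: "mobius_quotient y \<in> mobius_carrier \<delta>" if "y \<in> ?R" for y
      using that mobius_quotient_image by blast
    show ?thesis
    proof (cases "fst x = 2 * pi")
      case True
      then have shift: "mobius_shift (mobius_quotient x) = x"
        by (simp add: mobius_quotient_def mobius_shift_def prod_eq_iff)
      have "mobius_quotient y \<in> U" if y: "y \<in> ?R" "dist y x < e" for y
      proof (cases "fst y = 2 * pi")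
        case True
        \<comment> \<open>Both points lie on the right edge, and the shift is an isometry, so the
          first ball contains the image of \<open>y\<close>.\<close>
        have "mobius_shift (mobius_quotient y) = y"
          using True by (simp add: mobius_quotient_def mobius_shift_def prod_eq_iff)
        then have "dist (mobius_quotient x) (mobius_quotient y) < e"
          using y shift dist_mobius_shift by (metis dist_commute)
        then show ?thesis using e carrier[OF y(1)] by (auto simp: mobius_nbhd_def)
      next
        case False
        then have "mobius_quotient y = y" by (simp add: mobius_quotient_def)
        then show ?thesis
          using e carrier[OF y(1)] y shift by (auto simp: mobius_nbhd_def dist_commute)
      qed
      with e show ?thesis by blast
    next
      case False
      then have xx: "mobius_quotient x = x" by (simp add: mobius_quotient_def)
      have pos: "fst x < 2 * pi" using x False by auto
      \<comment> \<open>The radius is cut down to keep \<open>y\<close> off the right edge.\<close>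
      have "mobius_quotient y \<in> U" if y: "y \<in> ?R" "dist y x < min e (2 * pi - fst x)" for y
      proof -
        have "dist (fst y) (fst x) < 2 * pi - fst x"
          using y dist_fst_le[of y x] by linarith
        then have "fst y \<noteq> 2 * pi" by (auto simp: dist_real_def)
        then have "mobius_quotient y = y" by (simp add: mobius_quotient_def)
        then show ?thesis
          using e carrier[OF y(1)] y xx by (auto simp: mobius_nbhd_def dist_commute)
      qed
      with e pos show ?thesis by (intro exI[of _ "min e (2 * pi - fst x)"]) auto
    qed
  qed
  then show "openin (top_of_set ?R) {x \<in> topspace (top_of_set ?R). mobius_quotient x \<in> U}"
    unfolding openin_euclidean_subtopology_iff by fastforce
qed

lemma compact_space_mobius_strip: "compact_space (mobius_strip \<delta>)"
proof -
  have "compactin (top_of_set ({0..2 * pi} \<times> {-\<delta>..\<delta>})) ({0..2 * pi} \<times> {-\<delta>..\<delta>})"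
    by (simp add: compactin_subtopology compact_Times)
  from image_compactin[OF this continuous_map_mobius_quotient]
  show ?thesis by (simp add: mobius_quotient_image compact_space_def)
qed

text \<open>Half-angles in \<open>[0, pi)\<close> have nonnegative sines and are determined by their
  cosines. The last conjunct rules out the borderline case where both widths are
  \<open>sqrt 2\<close> in absolute value.\<close>

lemma mobius_double_point:
  fixes a b r q :: real
  assumes a: "0 \<le> a" "a < pi" and b: "0 \<le> b" "b < pi" and "a \<noteq> b"
    and eq: "mobius_map (2 * a, r) = mobius_map (2 * b, q)"
  shows "r\<^sup>2 = 4 * (cos a)\<^sup>2 \<and> q\<^sup>2 = 4 * (sin a)\<^sup>2 \<and> (sin a)\<^sup>2 \<noteq> (cos a)\<^sup>2"
proof -
  define S C S' C' where defs: "S = sin a" "C = cos a" "S' = sin b" "C' = cos b"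
  have SC: "S\<^sup>2 + C\<^sup>2 = 1" "S'\<^sup>2 + C'\<^sup>2 = 1" by (auto simp: defs)
  have nonneg: "0 \<le> S" "0 \<le> S'"
    using a b by (auto simp: defs sin_ge_zero)
  have "C \<noteq> C'"
    using cos_inj_pi[of a b] a b \<open>a \<noteq> b\<close> by (auto simp: defs)
  have eqs: "C\<^sup>2 - S\<^sup>2 + r * C = C'\<^sup>2 - S'\<^sup>2 + q * C'" "S * C = S' * C'" "r * S = q * S'"
    using eq by (auto simp: mobius_map_eq_iff cos_double sin_double defs)
  \<comment> \<open>Equal products on the unit circle leave four sign choices:
    \<open>(S', C')\<close> is \<open>(S, C)\<close> or \<open>(C, S)\<close> up to a common sign.
    The first pair is excluded for either sign.\<close>
  have "(S + C)\<^sup>2 = (S' + C')\<^sup>2" "(S - C)\<^sup>2 = (S' - C')\<^sup>2"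
    using SC eqs(2) by (simp_all add: power2_sum power2_diff)
  then have *: "S' + C' = S + C \<or> S' + C' = - (S + C)" "S' - C' = S - C \<or> S' - C' = - (S - C)"
    by (metis power2_eq_iff)+
  then consider (swap) "S' = C" "C' = S" | (neg) "S' = - C" "C' = - S"
  proof -
    have "\<not> (S' = - S \<and> C' = - C)"
    proof
      assume "S' = - S \<and> C' = - C"
      then have "S = 0" "S' = 0" using nonneg by auto
      then have "a = 0" "b = 0"
        using sin_gt_zero[of a] sin_gt_zero[of b] a b by (force simp: defs)+
      with \<open>a \<noteq> b\<close> show False by simp
    qed
    moreover have "\<not> (S' = S \<and> C' = C)" using \<open>C \<noteq> C'\<close> by simp
    ultimately show thesis
      using * swap neg by argo
  qed
  then show ?thesis
  proof cases
    case swap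
    have ne: "S\<^sup>2 \<noteq> C\<^sup>2"
      using swap nonneg \<open>C \<noteq> C'\<close> by (auto simp: power2_eq_iff)
    \<comment> \<open>Cramer's rule for the linear system in \<open>r\<close> and \<open>q\<close>,
      whose determinant is \<open>S\<^sup>2 - C\<^sup>2\<close> up to sign.\<close>
    have "(r + 2 * C) * (S\<^sup>2 - C\<^sup>2) = 0" "(q + 2 * S) * (S\<^sup>2 - C\<^sup>2) = 0"
      using eqs SC unfolding swap by algebra+
    then have "r = - 2 * C" "q = - 2 * S" using ne by auto
    then show ?thesis using ne by (simp add: defs power_mult_distrib)
  next
    case neg
    have ne: "S\<^sup>2 \<noteq> C\<^sup>2"
      using neg nonneg \<open>C \<noteq> C'\<close> by (auto simp: power2_eq_iff)
    have "(r + 2 * C) * (S\<^sup>2 - C\<^sup>2) = 0" "(q - 2 * S) * (S\<^sup>2 - C\<^sup>2) = 0"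
      using eqs SC unfolding neg by algebra+
    then have "r = - 2 * C" "q = 2 * S" using ne by auto
    then show ?thesis using ne by (simp add: defs power_mult_distrib)
  qed
qed

lemma inj_on_mobius_map:
  assumes "\<delta> \<le> sqrt 2"
  shows "inj_on mobius_map (mobius_carrier \<delta>)"
proof (rule inj_onI, clarify)
  fix t r s q
  assume p: "(t, r) \<in> mobius_carrier \<delta>" and p': "(s, q) \<in> mobius_carrier \<delta>"
    and eq: "mobius_map (t, r) = mobius_map (s, q)"
  have bound: "x\<^sup>2 \<le> 2" if "- \<delta> \<le> x" "x \<le> \<delta>" for x
  proof -
    have "\<bar>x\<bar> \<le> sqrt 2" using that assms by linarith
    then show ?thesis by (metis real_sqrt_abs real_sqrt_le_iff)
  qed
  have le: "r\<^sup>2 \<le> 2" "q\<^sup>2 \<le> 2"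
    using p p' by (auto simp: mobius_carrier_def intro: bound)
  have "t = s"
  proof (rule ccontr)
    assume "t \<noteq> s"
    then have "r\<^sup>2 = 4 * (cos (t/2))\<^sup>2 \<and> q\<^sup>2 = 4 * (sin (t/2))\<^sup>2 \<and> (sin (t/2))\<^sup>2 \<noteq> (cos (t/2))\<^sup>2"
      using p p' eq by (intro mobius_double_point[of _ "s/2"]) (auto simp: mobius_carrier_def)
    \<comment> \<open>Both squares are at most 1/2 and sum to 1, so they would be equal.\<close>
    with le sin_cos_squared_add[of "t/2"] show False by linarith
  qed
  moreover have "r = q"
  proof -
    have "cos (t/2) \<noteq> 0 \<or> sin (t/2) \<noteq> 0"
      using sin_zero_norm_cos_one[of "t/2"] by auto
    with eq \<open>t = s\<close> show ?thesis by (auto simp: mobius_map_eq_iff)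
  qed
  ultimately show "t = s \<and> r = q" by simp
qed

text \<open>Along this curve the image depends on \<open>sin t\<close> alone, so \<open>t\<close>
  and \<open>pi - t\<close> collide.\<close>

lemma mobius_map_fold: "mobius_map (t, - 2 * cos (t / 2)) = vector [-1, 0, - sin t]"
  using cos_double_cos[of "t/2"] sin_double[of "t/2"]
  by (simp add: mobius_map_def power2_eq_square mult.commute mult.left_commute)

lemma not_inj_on_mobius_map:
  assumes "sqrt 2 < \<delta>"
  shows "\<not> inj_on mobius_map (mobius_carrier \<delta>)"
proof
  assume inj: "inj_on mobius_map (mobius_carrier \<delta>)"
  \<comment> \<open>The choice of \<open>a\<close> makes \<open>m = 2 * sin a\<close> the larger of
    the two widths in absolute value; capping at 2 keeps the argument of \<open>arcsin\<close> at
    most 1.\<close>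
  define m where "m = min \<delta> 2"
  define a where "a = arcsin (m / 2)"
  have "sqrt 2 < (2::real)" by (simp add: real_less_lsqrt)
  then have m: "sqrt 2 < m" "m \<le> 2" "m \<le> \<delta>" using assms by (auto simp: m_def)
  have "0 < sqrt (2::real)" by simp
  with m have m0: "0 < m" by linarith
  have sin_a: "sin a = m / 2" using m m0 by (simp add: a_def)
  have a: "- (pi/2) \<le> a" "a \<le> pi/2"
    using arcsin_bounded[of "m/2"] m m0 by (auto simp: a_def)
  then have a': "a < pi" using pi_gt_zero by linarith
  have a0: "0 \<le> a"
    using a sin_a m0 sin_le_zero[of "-a"] sin_ge_zero[of "-a"] by (cases "0 \<le> a") auto
  then have a_neg: "- (2 * a) < pi" using pi_gt_zero by linarith
  have cos_a: "0 \<le> cos a" using a by (simp add: cos_ge_zero)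
  have "(sqrt 2)\<^sup>2 < m\<^sup>2" using m by (intro power_strict_mono) auto
  then have "m\<^sup>2 > 2" by simp
  then have "(2 * cos a)\<^sup>2 < (sqrt 2)\<^sup>2"
    using sin_cos_squared_add[of a] by (simp add: sin_a power_mult_distrib power_divide)
  then have cos_lt: "2 * cos a < sqrt 2"
    by (rule power_less_imp_less_base) simp
  have half: "(pi - 2 * a) / 2 = pi/2 - a" by (simp add: field_simps)
  have "mobius_map (2 * a, - 2 * cos a) = mobius_map (pi - 2 * a, - 2 * sin a)"
    using mobius_map_fold[of "2 * a"] mobius_map_fold[of "pi - 2 * a"]
    by (simp add: half cos_diff)
  moreover have "(2 * a, - 2 * cos a) \<in> mobius_carrier \<delta>"
    using a' a0 cos_a cos_lt assms unfolding mobius_carrier_def by simp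
  moreover have "(pi - 2 * a, - 2 * sin a) \<in> mobius_carrier \<delta>"
    using a a_neg m m0 unfolding mobius_carrier_def sin_a by simp
  ultimately have "(2 * a, - 2 * cos a) = (pi - 2 * a, - 2 * sin a)"
    using inj by (meson inj_onD)
  \<comment> \<open>The widths differ, as \<open>2 * cos a < sqrt 2 < m = 2 * sin a\<close>.\<close>
  then show False using sin_a cos_lt m by simp
qed

theorem theorem1p1:
  fixes \<delta> :: real
  assumes "\<delta> > 0"
  shows "homeomorphic_map (mobius_strip \<delta>)
           (top_of_set (mobius_map ` mobius_carrier \<delta>)) mobius_map
         \<longleftrightarrow> \<delta> \<le> sqrt 2"
proof
  assume "homeomorphic_map (mobius_strip \<delta>)
           (top_of_set (mobius_map ` mobius_carrier \<delta>)) mobius_map"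
  then have "inj_on mobius_map (mobius_carrier \<delta>)"
    using homeomorphic_imp_injective_map by fastforce
  then show "\<delta> \<le> sqrt 2"
    using not_inj_on_mobius_map by force
next
  assume "\<delta> \<le> sqrt 2"
  then show "homeomorphic_map (mobius_strip \<delta>)
           (top_of_set (mobius_map ` mobius_carrier \<delta>)) mobius_map"
    using compact_space_mobius_strip continuous_map_mobius_map inj_on_mobius_map
    by (intro continuous_imp_homeomorphic_map) (auto simp: Hausdorff_space_subtopology)
qed

end
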